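(* Let $\beta\in(0,\infty)$ and let $(X_n)_{n\ge 0}$ be the Ant RW with strength of reinforcement $\beta$ on the graph $\mathbb{Z}$ (with nearest-neighbour edges), started from $X_0=0$. Then $(X_n)_{n\ge 0}$ is a Markov chain with transition probabilities $$\mathbb{P}(X_{n+1}=1\mid X_n=0)=\mathbb{P}(X_{n+1}=-1\mid X_n=0)=\tfrac12,$$ $$\mathbb{P}(X_{n+1}=x+1\mid X_n=x)=\begin{cases}\dfrac{1}{1+e^{-\beta}}, & x\ge 1,\\[2mm] \dfrac{e^{-\beta}}{1+e^{-\beta}}, & x\le -1,\end{cases}$$ $$\mathbb{P}(X_{n+1}=x-1\mid X_n=x)=\begin{cases}\dfrac{e^{-\beta}}{1+e^{-\beta}}, & x\ge 1,\\[2mm] \dfrac{1}{1+e^{-\beta}}, & x\le -1.\end{cases}$$ In particular, the Ant RW on $\mathbb{Z}$ is transient, and it satisfies the following law of large numbers: there is a random variable $Y$ such that $$\lim_{n\to\infty}\frac{X_n}{n}=Y\quad\text{almost surely},$$ where $\mathbb{P}\Big[Y=\frac{1-e^{-\beta}}{1+e^{-\beta}}\Big]=\mathbb{P}\Big[Y=-\frac{1-e^{-\beta}}{1+e^{-\beta}}\Big]=\frac12$.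
   Context: Ant RW (directed edge reinforced random walk). Let $G=(V,E)$ be a locally finite, connected, undirected graph; write $v\sim w$ if $v,w$ form an edge. For $\beta\in(0,\infty)$ and a starting vertex $v$, the Ant RW is the $V$-valued process $(X_n)_{n\ge 0}$ with $X_0=v$ and, for $n\ge 0$ and $x\sim X_n$, $$\mathbb{P}(X_{n+1}=x\mid \mathcal{G}_n)=\frac{a_n(X_n,x)}{\sum_{y\sim X_n}a_n(X_n,y)},\qquad \mathcal{G}_n=\sigma(X_0,\dots,X_n),$$ with weights $a_n(x,y)=\exp\{\beta\,c_n(x,y)\}$ and crossing numbers $$c_n(x,y)=\sum_{k=0}^{n-1}\Big(\mathbf{1}[(X_k,X_{k+1})=(x,y)]-\mathbf{1}[(X_k,X_{k+1})=(y,x)]\Big)$$ (so $c_0\equiv 0$). *)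

theory Defs
  imports "HOL-Probability.Probability"
begin

text \<open>The vertex set of a graph is the whole type \<open>'v\<close>, its edges are given by the adjacency
  relation \<open>adj\<close>.\<close>

locale locally_finite_connected_graph =
  fixes adj :: "'v \<Rightarrow> 'v \<Rightarrow> bool"
  assumes adj_sym: "adj x y \<Longrightarrow> adj y x"
    and locally_finite: "finite {y. adj x y}"
    and connected_graph: "adj\<^sup>*\<^sup>* x y"

definition natural_filtration :: "'a measure \<Rightarrow> (nat \<Rightarrow> 'a \<Rightarrow> 'v) \<Rightarrow> nat \<Rightarrow> 'a measure" where
  "natural_filtration M X n = sigma (space M) {X k -` A \<inter> space M | k A. k \<le> n}"

text \<open>\<open>\<P>(X\<^sub>n\<^sub>+\<^sub>1 = y | \<sigma>(X\<^sub>0, \<dots>, X\<^sub>n))\<close>, a version of the conditional expectation; it is determined only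
  almost surely, so every condition on it below is stated almost everywhere.\<close>

definition next_step_prob :: "'a measure \<Rightarrow> (nat \<Rightarrow> 'a \<Rightarrow> 'v) \<Rightarrow> nat \<Rightarrow> 'v \<Rightarrow> 'a \<Rightarrow> real" where
  "next_step_prob M X n y =
     real_cond_exp M (natural_filtration M X n) (indicator {\<omega> \<in> space M. X (Suc n) \<omega> = y})"

definition crossing_number :: "(nat \<Rightarrow> 'v) \<Rightarrow> nat \<Rightarrow> 'v \<Rightarrow> 'v \<Rightarrow> int" where
  "crossing_number w n x y =
     (\<Sum>k<n. of_bool ((w k, w (Suc k)) = (x, y)) - of_bool ((w k, w (Suc k)) = (y, x)))"

definition ant_weight :: "real \<Rightarrow> (nat \<Rightarrow> 'v) \<Rightarrow> nat \<Rightarrow> 'v \<Rightarrow> 'v \<Rightarrow> real" where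
  "ant_weight \<beta> w n x y = exp (\<beta> * real_of_int (crossing_number w n x y))"

locale ant_random_walk = prob_space M + locally_finite_connected_graph adj
  for M :: "'a measure" and adj :: "'v \<Rightarrow> 'v \<Rightarrow> bool" +
  fixes \<beta> :: real and v :: 'v and X :: "nat \<Rightarrow> 'a \<Rightarrow> 'v"
  assumes \<beta>_pos: "0 < \<beta>"
    and X_measurable: "X n \<in> measurable M (count_space UNIV)"
    and X_start: "AE \<omega> in M. X 0 \<omega> = v"
    and X_step: "AE \<omega> in M. adj (X n \<omega>) x \<longrightarrow>
      next_step_prob M X n x \<omega> =
        ant_weight \<beta> (\<lambda>k. X k \<omega>) n (X n \<omega>) x /
        (\<Sum>y | adj (X n \<omega>) y. ant_weight \<beta> (\<lambda>k. X k \<omega>) n (X n \<omega>) y)"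

text \<open>Time-homogeneous, with respect to the natural filtration, with arbitrary initial law.\<close>

definition markov_chain :: "'a measure \<Rightarrow> (nat \<Rightarrow> 'a \<Rightarrow> 'v) \<Rightarrow> ('v \<Rightarrow> 'v \<Rightarrow> real) \<Rightarrow> bool" where
  "markov_chain M X p \<longleftrightarrow>
     (\<forall>x y. 0 \<le> p x y) \<and> (\<forall>x. (p x has_sum 1) UNIV) \<and>
     (\<forall>n. X n \<in> measurable M (count_space UNIV)) \<and>
     (\<forall>n y. AE \<omega> in M. next_step_prob M X n y \<omega> = p (X n \<omega>) y)"

text \<open>Almost surely every vertex is visited only finitely often. This is meaningful for processes that
  are not Markov; the quantifier over \<open>x\<close> stands outside since state spaces here are countable.\<close>

definition transient :: "'a measure \<Rightarrow> (nat \<Rightarrow> 'a \<Rightarrow> 'v) \<Rightarrow> bool" where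
  "transient M X \<longleftrightarrow> (\<forall>x. AE \<omega> in M. finite {n. X n \<omega> = x})"

definition nearest_neighbour :: "int \<Rightarrow> int \<Rightarrow> bool" where
  "nearest_neighbour x y \<longleftrightarrow> \<bar>x - y\<bar> = 1"

definition ant_transition :: "real \<Rightarrow> int \<Rightarrow> int \<Rightarrow> real" where
  "ant_transition \<beta> x y =
     (if \<not> nearest_neighbour x y then 0
      else if x = 0 then 1 / 2
      else if \<bar>y\<bar> = \<bar>x\<bar> + 1 then 1 / (1 + exp (- \<beta>))
      else exp (- \<beta>) / (1 + exp (- \<beta>)))"

lemma nearest_neighbour_graph: "locally_finite_connected_graph nearest_neighbour"
proof
  fix x y :: int
  show "nearest_neighbour y x" if "nearest_neighbour x y"
    using that by (simp add: nearest_neighbour_def)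
  have "{y. nearest_neighbour x y} \<subseteq> {x - 1..x + 1}"
    by (auto simp: nearest_neighbour_def)
  then show "finite {y. nearest_neighbour x y}"
    using finite_subset by blast
  have up: "nearest_neighbour\<^sup>*\<^sup>* a (a + int k)" for a k
    by (induction k) (auto simp: nearest_neighbour_def intro: rtranclp.rtrancl_into_rtrancl)
  have down: "nearest_neighbour\<^sup>*\<^sup>* a (a - int k)" for a k
    by (induction k) (auto simp: nearest_neighbour_def intro: rtranclp.rtrancl_into_rtrancl)
  show "nearest_neighbour\<^sup>*\<^sup>* x y"
    using up[of x "nat (y - x)"] down[of x "nat (x - y)"] by (cases "x \<le> y") auto
qed

end

theory Submission
  imports Defs
begin

text \<open>On a tree the crossing numbers telescope along the path, so the weights at the current vertex
  depend on that vertex only and the walk is Markov with drift away from \<open>0\<close>. If \<open>f \<ge> 0\<close> and the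
  transition operator maps \<open>f\<close> below \<open>\<rho> f\<close>, then the expectation of \<open>f (X\<^sub>n)\<close> is at most \<open>\<rho>\<^sup>n f 0\<close>;
  exponential functions of \<open>\<bar>x\<bar>\<close> together with Borel-Cantelli squeeze \<open>\<bar>X\<^sub>n\<bar> / n\<close> to the drift, which
  also gives transience. Finally \<open>sgn x (1 - exp (- \<beta> \<bar>x\<bar>))\<close> is bounded and harmonic, and along the walk
  it converges to the limiting sign, so both signs are equally likely.\<close>

section \<open>Crossing numbers of nearest-neighbour paths\<close>

lemma crossing_number_swap: "crossing_number w n y x = - crossing_number w n x y"
  by (simp add: crossing_number_def sum_negf[symmetric])

text \<open>A path with unit steps changes the indicator of \<open>x < w n\<close> exactly when it
  crosses the edge between \<open>x\<close> and \<open>x + 1\<close>, and by the sign of that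
  crossing. The signed crossings therefore telescope.\<close>

lemma crossing_number_up:
  assumes "\<And>k. k < n \<Longrightarrow> nearest_neighbour (w k) (w (Suc k))"
  shows "crossing_number w n x (x + 1) = of_bool (x < w n) - of_bool (x < w 0)"
  using assms
proof (induction n)
  case 0
  then show ?case by (simp add: crossing_number_def)
next
  case (Suc n)
  have "\<bar>w n - w (Suc n)\<bar> = 1"
    using Suc.prems[of n] by (simp add: nearest_neighbour_def)
  then have "w (Suc n) = w n + 1 \<or> w (Suc n) = w n - 1"
    by linarith
  then have "of_bool ((w n, w (Suc n)) = (x, x + 1)) - of_bool ((w n, w (Suc n)) = (x + 1, x))
      = (of_bool (x < w (Suc n)) - of_bool (x < w n) :: int)"
    by (auto simp: of_bool_def)
  moreover have "crossing_number w n x (x + 1) = of_bool (x < w n) - of_bool (x < w 0)"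
    using Suc by simp
  ultimately show ?case
    by (simp add: crossing_number_def)
qed

lemma neighbours_int: "{y. nearest_neighbour x y} = {x - 1, x + 1}"
  by (auto simp: nearest_neighbour_def)

text \<open>For a path from \<open>0\<close>, only the edge at \<open>w n\<close> pointing towards
  \<open>0\<close> can have a nonzero crossing number. It has been crossed outwards once more than
  inwards, so read from \<open>w n\<close> its number is -1 and its weight
  \<open>exp (- \<beta>)\<close>. The outward edge has weight 1, and at \<open>0\<close> both edges
  do.\<close>

lemma ant_weight_ratio:
  assumes path: "\<And>k. k < n \<Longrightarrow> nearest_neighbour (w k) (w (Suc k))"
    and start: "w 0 = 0" and adj: "nearest_neighbour (w n) y"
  shows "ant_weight \<beta> w n (w n) y / (\<Sum>z | nearest_neighbour (w n) z. ant_weight \<beta> w n (w n) z)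
    = ant_transition \<beta> (w n) y"
proof -
  have up: "crossing_number w n (w n) (w n + 1) = - of_bool (w n < 0)"
    using crossing_number_up[of n w "w n"] path start by simp
  \<comment> \<open>The lower edge is counted upwards from \<open>w n - 1\<close> and then reversed
    by antisymmetry.\<close>
  have down: "crossing_number w n (w n) (w n - 1) = - of_bool (0 < w n)"
    using crossing_number_up[of n w "w n - 1"] path start
      crossing_number_swap[of w n "w n" "w n - 1"]
    by (auto simp: of_bool_def)
  define x where "x = w n"
  have weights: "ant_weight \<beta> w n x (x + 1) = (if x < 0 then exp (- \<beta>) else 1)"
    "ant_weight \<beta> w n x (x - 1) = (if 0 < x then exp (- \<beta>) else 1)"
    using up down by (simp_all add: ant_weight_def x_def)
  have sum: "(\<Sum>z | nearest_neighbour x z. ant_weight \<beta> w n x z)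
      = ant_weight \<beta> w n x (x + 1) + ant_weight \<beta> w n x (x - 1)"
    by (simp add: neighbours_int)
  have "y = x - 1 \<or> y = x + 1"
    using adj by (auto simp: nearest_neighbour_def x_def)
  then show ?thesis
    unfolding x_def[symmetric] sum
    by (elim disjE; simp only: weights; auto simp: ant_transition_def nearest_neighbour_def add.commute)
qed

section \<open>Stochasticity of the transition kernel\<close>

lemma ant_transition_nonneg: "0 \<le> ant_transition \<beta> x y"
  by (simp add: ant_transition_def add_nonneg_nonneg)

lemma ant_transition_sum: "ant_transition \<beta> x (x - 1) + ant_transition \<beta> x (x + 1) = 1"
proof -
  have "1 + exp (- \<beta>) \<noteq> 0"
    by (metis add_pos_pos exp_gt_zero less_irrefl zero_less_one)
  then show ?thesis
    by (auto simp: ant_transition_def nearest_neighbour_def add_divide_distrib[symmetric] add.commute)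
qed

lemma ant_transition_has_sum: "(ant_transition \<beta> x has_sum 1) UNIV"
proof (rule has_sum_cong_neutral[THEN iffD1])
  show "(ant_transition \<beta> x has_sum 1) {x - 1, x + 1}"
    using has_sum_finite[of "{x - 1, x + 1}" "ant_transition \<beta> x"] ant_transition_sum[of \<beta> x]
    by simp
qed (auto simp: ant_transition_def nearest_neighbour_def)

section \<open>One-step probabilities\<close>

lemma space_natural_filtration [simp]: "space (natural_filtration M X n) = space M"
  by (simp add: natural_filtration_def space_measure_of_conv)

lemma sets_natural_filtration:
  "sets (natural_filtration M X n) = sigma_sets (space M) {X k -` A \<inter> space M | k A. k \<le> n}"
  unfolding natural_filtration_def by (rule sets_measure_of) auto

lemma subalgebra_natural_filtration:
  assumes "\<And>k. X k \<in> measurable M (count_space UNIV)"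
  shows "subalgebra M (natural_filtration M X n)"
  unfolding subalgebra_def sets_natural_filtration
  by (auto intro!: sets.sigma_sets_subset measurable_sets[OF assms])

lemma measurable_natural_filtration:
  assumes "k \<le> n"
  shows "X k \<in> measurable (natural_filtration M X n) (count_space UNIV)"
  by (rule measurableI) (use assms in \<open>auto simp: sets_natural_filtration\<close>)

text \<open>The event \<open>X n = x\<close> belongs to the filtration at time \<open>n\<close>, so
  the indicator of the next step may be replaced by its conditional expectation when integrating
  over it. The value \<open>c\<close> is required on this event only, which allows the lemma to be
  applied before the Markov property is known.\<close>

lemma (in prob_space) prob_next_step:
  assumes meas: "\<And>k. X k \<in> measurable M (count_space UNIV)"
    and const: "AE \<omega> in M. X n \<omega> = x \<longrightarrow> next_step_prob M X n y \<omega> = c"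
  shows "\<P>(\<omega> in M. X n \<omega> = x \<and> X (Suc n) \<omega> = y) = c * \<P>(\<omega> in M. X n \<omega> = x)"
proof -
  note [measurable] = meas
  interpret finite_measure_subalgebra M "natural_filtration M X n"
    using subalgebra_natural_filtration[OF meas]
    by (simp add: finite_measure_subalgebra_def finite_measure_subalgebra_axioms_def finite_measure_axioms)
  let ?A = "{\<omega> \<in> space M. X n \<omega> = x}" and ?B = "{\<omega> \<in> space M. X (Suc n) \<omega> = y}"
  have A: "?A \<in> sets (natural_filtration M X n)"
    using measurable_sets[OF measurable_natural_filtration[of n n X M], of "{x}"]
    by (simp add: vimage_def Int_def conj_commute)
  have "\<P>(\<omega> in M. X n \<omega> = x \<and> X (Suc n) \<omega> = y) = (\<integral>\<omega>. indicator (?A \<inter> ?B) \<omega> \<partial>M)"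
    by (simp add: Collect_conj_eq[symmetric] conj_ac Int_def)
  also have "\<dots> = (LINT \<omega>:?A|M. indicator ?B \<omega>)"
    by (simp add: set_lebesgue_integral_def indicator_inter_arith)
  also have "\<dots> = (LINT \<omega>:?A|M. next_step_prob M X n y \<omega>)"
    unfolding next_step_prob_def 
    by (intro real_cond_exp_intA A integrable_real_indicator) (auto simp: less_top[symmetric])
  also have "\<dots> = (LINT \<omega>:?A|M. c)"
    unfolding set_lebesgue_integral_def
    by (rule integral_cong_AE)
      (use const in \<open>auto simp: next_step_prob_def split: split_indicator\<close>)
  also have "\<dots> = c * \<P>(\<omega> in M. X n \<omega> = x)"
    by (simp add: set_lebesgue_integral_def)
  finally show ?thesis .
qed

text \<open>The step rule of the walk speaks of neighbours only; this lemma handles all other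
  targets. The indicator of \<open>P (X n \<omega>)\<close> is measurable for the filtration and can
  be pulled out of the conditional expectation of a product that vanishes almost surely.\<close>

lemma (in prob_space) next_step_prob_eq_0:
  assumes meas: "\<And>k. X k \<in> measurable M (count_space UNIV)"
    and null: "AE \<omega> in M. P (X n \<omega>) \<longrightarrow> X (Suc n) \<omega> \<noteq> y"
  shows "AE \<omega> in M. P (X n \<omega>) \<longrightarrow> next_step_prob M X n y \<omega> = 0"
proof -
  note [measurable] = meas
  interpret finite_measure_subalgebra M "natural_filtration M X n"
    using subalgebra_natural_filtration[OF meas]
    by (simp add: finite_measure_subalgebra_def finite_measure_subalgebra_axioms_def finite_measure_axioms)
  let ?B = "{\<omega> \<in> space M. X (Suc n) \<omega> = y}"
  let ?g = "\<lambda>\<omega>. of_bool (P (X n \<omega>)) :: real"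
  have g: "?g \<in> borel_measurable (natural_filtration M X n)"
    by (rule measurable_compose[OF measurable_natural_filtration]) auto
  have [measurable]: "?g \<in> borel_measurable M"
    by (rule measurable_compose[OF meas]) auto
  have zero: "AE \<omega> in M. ?g \<omega> * indicator ?B \<omega> = 0"
    using null by eventually_elim auto
  have "AE \<omega> in M. real_cond_exp M (natural_filtration M X n) (\<lambda>\<omega>. ?g \<omega> * indicator ?B \<omega>) \<omega>
      = ?g \<omega> * next_step_prob M X n y \<omega>"
    unfolding next_step_prob_def
  proof (rule real_cond_exp_mult[OF g])
    have "integrable M (\<lambda>_. 0 :: real)" by simp
    then show "integrable M (\<lambda>\<omega>. ?g \<omega> * indicator ?B \<omega>)"
      by (rule integrable_cong_AE_imp) (use zero in auto)
  qed auto
  moreover have "AE \<omega> in M. real_cond_exp M (natural_filtration M X n)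
      (\<lambda>\<omega>. ?g \<omega> * indicator ?B \<omega>) \<omega> = real_cond_exp M (natural_filtration M X n) (\<lambda>_. 0) \<omega>"
    by (rule real_cond_exp_cong) (use zero in auto)
  moreover have "AE \<omega> in M. real_cond_exp M (natural_filtration M X n) (\<lambda>_. 0) \<omega> = 0"
    by (rule real_cond_exp_F_meas) auto
  ultimately show ?thesis
    by eventually_elim auto
qed

section \<open>The transition operator\<close>

definition outward :: "real \<Rightarrow> real" where "outward \<beta> = 1 / (1 + exp (- \<beta>))"

definition inward :: "real \<Rightarrow> real" where "inward \<beta> = exp (- \<beta>) / (1 + exp (- \<beta>))"

text \<open>Two terms suffice, since the kernel vanishes off the neighbours of
  \<open>x\<close>.\<close>

definition ant_operator :: "real \<Rightarrow> (int \<Rightarrow> real) \<Rightarrow> int \<Rightarrow> real" where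
  "ant_operator \<beta> f x =
     ant_transition \<beta> x (x + 1) * f (x + 1) + ant_transition \<beta> x (x - 1) * f (x - 1)"

lemma outward_inward_pos: "0 < outward \<beta>" "0 < inward \<beta>"
  by (simp_all add: outward_def inward_def add_pos_pos)

lemma outward_add_inward: "outward \<beta> + inward \<beta> = 1"
  using add_pos_pos[OF zero_less_one exp_gt_zero[of "- \<beta>"]]
  by (simp add: outward_def inward_def add_divide_distrib[symmetric])

lemma inward_eq: "inward \<beta> = exp (- \<beta>) * outward \<beta>"
  by (simp add: outward_def inward_def)

lemma inward_less_outward: "0 < \<beta> \<Longrightarrow> inward \<beta> < outward \<beta>"
  using outward_inward_pos(1)[of \<beta>] by (simp add: inward_eq)

text \<open>On functions of the distance to \<open>0\<close> the operator is that of a biased walk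
  on the nonnegative integers reflected at 0, because from \<open>0\<close> both neighbours have
  distance 1.\<close>

lemma ant_operator_abs:
  "ant_operator \<beta> (\<lambda>y. F (real_of_int \<bar>y\<bar>)) x =
    (if x = 0 then F 1 else outward \<beta> * F (\<bar>x\<bar> + 1) + inward \<beta> * F (\<bar>x\<bar> - 1))"
proof -
  consider "x = 0" | "x > 0" | "x < 0" by linarith
  then show ?thesis
  proof cases
    case 1
    then show ?thesis
      by (simp add: ant_operator_def ant_transition_def nearest_neighbour_def)
  next
    case 2
    then have "\<bar>x + 1\<bar> = \<bar>x\<bar> + 1" "\<bar>x - 1\<bar> = \<bar>x\<bar> - 1" by linarith+
    with 2 show ?thesis
      by (simp add: ant_operator_def ant_transition_def nearest_neighbour_def outward_def inward_def
          del: of_int_abs)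
  next
    case 3
    then have "\<bar>x + 1\<bar> = \<bar>x\<bar> - 1" "\<bar>x - 1\<bar> = \<bar>x\<bar> + 1" by linarith+
    with 3 show ?thesis
      by (simp add: ant_operator_def ant_transition_def nearest_neighbour_def outward_def inward_def
          del: of_int_abs)
  qed
qed

text \<open>The ratio of \<open>inward \<beta>\<close> to \<open>outward \<beta>\<close> is
  \<open>exp (- \<beta>)\<close>, so this exponential is the harmonic function of gambler's ruin for
  the biased walk.\<close>

lemma outward_inward_exp_balance:
  "outward \<beta> * exp (- (\<beta> * (r + 1))) + inward \<beta> * exp (- (\<beta> * (r - 1))) = exp (- (\<beta> * r))"
proof -
  have "outward \<beta> * exp (- (\<beta> * (r + 1))) + inward \<beta> * exp (- (\<beta> * (r - 1)))
    = outward \<beta> * (exp (- (\<beta> * r)) * exp (- \<beta>)) + exp (- \<beta>) * outward \<beta> * (exp (- (\<beta> * r)) * exp \<beta>)"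
    by (simp add: inward_eq exp_add[symmetric] algebra_simps)
  also have "\<dots> = exp (- (\<beta> * r)) * (outward \<beta> * exp (- \<beta>) + outward \<beta> * (exp (- \<beta>) * exp \<beta>))"
    by (simp add: algebra_simps)
  also have "\<dots> = exp (- (\<beta> * r)) * (inward \<beta> + outward \<beta>)"
    by (simp add: inward_eq exp_minus_inverse exp_add[symmetric])
  finally show ?thesis
    using outward_add_inward[of \<beta>] by (simp add: add.commute)
qed

text \<open>The odd extension of the probability that the walk started at a positive
  \<open>x\<close> never hits \<open>0\<close>.\<close>

definition ant_harmonic :: "real \<Rightarrow> int \<Rightarrow> real" where
  "ant_harmonic \<beta> x = sgn (real_of_int x) * (1 - exp (- (\<beta> * \<bar>real_of_int x\<bar>)))"

text \<open>At \<open>0\<close> the two neighbours cancel by oddness; elsewhere constants are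
  preserved and the exponential part is handled by
  \<open>outward_inward_exp_balance\<close>.\<close>

lemma ant_operator_harmonic: "ant_operator \<beta> (ant_harmonic \<beta>) = ant_harmonic \<beta>"
proof
  fix x :: int
  let ?h = "ant_harmonic \<beta>"
  define b where "b r = outward \<beta> * exp (- (\<beta> * (r + 1))) + inward \<beta> * exp (- (\<beta> * (r - 1)))" for r
  \<comment> \<open>This closed form and the next one both include \<open>0\<close>, so a nonzero
    vertex and its two neighbours always fall under the same one.\<close>
  have h: "?h y = 1 - exp (- (\<beta> * y))" if "y \<ge> 0" for y
    using that by (cases "y = 0") (auto simp: ant_harmonic_def)
  have h': "?h y = - (1 - exp (- (\<beta> * (- y))))" if "y \<le> 0" for y
    using that by (cases "y = 0") (auto simp: ant_harmonic_def)
  consider "x = 0" | "x > 0" | "x < 0" by linarith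
  then show "ant_operator \<beta> ?h x = ?h x"
  proof cases
    case 1
    then show ?thesis
      by (simp add: ant_operator_def ant_transition_def nearest_neighbour_def ant_harmonic_def
          add_divide_distrib[symmetric])
  next
    case 2
    then have "ant_operator \<beta> ?h x = outward \<beta> * ?h (x + 1) + inward \<beta> * ?h (x - 1)"
      by (simp add: ant_operator_def ant_transition_def nearest_neighbour_def outward_def inward_def)
    also have "\<dots> = outward \<beta> + inward \<beta> - b x"
      using 2 by (simp add: h b_def right_diff_distrib)
    finally show ?thesis
      using 2 by (simp add: h b_def outward_add_inward outward_inward_exp_balance)
  next
    case 3
    then have "ant_operator \<beta> ?h x = outward \<beta> * ?h (x - 1) + inward \<beta> * ?h (x + 1)"
      by (simp add: ant_operator_def ant_transition_def nearest_neighbour_def outward_def inward_def)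
    also have "\<dots> = - (outward \<beta> + inward \<beta>) + b (- real_of_int x)"
      using 3 by (simp add: h' b_def right_diff_distrib)
    finally show ?thesis
      unfolding b_def outward_inward_exp_balance outward_add_inward using 3 by (simp add: h')
  qed
qed

text \<open>The expression equals 1 at \<open>t = 0\<close> and has derivative
  \<open>a - (p - q)\<close> there, which is negative; a small positive \<open>t\<close> brings it
  below 1. This is the parameter choice of a Chernoff bound.\<close>

lemma exists_exponential_tilt:
  fixes p q a :: real
  assumes "p + q = 1" "a < p - q"
  shows "\<exists>t>0. exp (t * a) * (p * exp (- t) + q * exp t) < 1"
proof -
  let ?f = "\<lambda>t. exp (t * a) * (p * exp (- t) + q * exp t)"
  have "DERIV ?f 0 :> a * (p + q) + (q - p)"
    by (auto intro!: derivative_eq_intros simp: algebra_simps)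
  moreover have "a * (p + q) + (q - p) < 0"
    using assms by simp
  ultimately obtain d where d: "d > 0" "\<And>h. 0 < h \<Longrightarrow> h < d \<Longrightarrow> ?f (0 + h) < ?f 0"
    using DERIV_neg_dec_right by blast
  show ?thesis
    using d(1) d(2)[of "d / 2"] assms(1) by (intro exI[of _ "d / 2"]) auto
qed

text \<open>A purely pathwise argument: positive speed of the distance forces the path to infinity,
  so it eventually avoids \<open>0\<close>, and unit steps cannot change sign without visiting
  \<open>0\<close>. The limiting sign is \<open>s\<close>.\<close>

lemma nearest_neighbour_path_speed:
  fixes w :: "nat \<Rightarrow> int" and \<mu> \<beta> :: real
  assumes path: "\<And>n. nearest_neighbour (w n) (w (Suc n))"
    and speed: "(\<lambda>n. \<bar>w n\<bar> / n) \<longlonglongrightarrow> \<mu>" and \<mu>: "0 < \<mu>" and \<beta>: "0 < \<beta>"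
  shows "finite {n. w n = x}"
    and "\<exists>s::real. (s = 1 \<or> s = -1) \<and> (\<lambda>n. w n / n) \<longlonglongrightarrow> s * \<mu>
      \<and> (\<lambda>n. ant_harmonic \<beta> (w n)) \<longlonglongrightarrow> s"
proof -
  have "filterlim (\<lambda>n. (\<bar>w n\<bar> / n) * real n) at_top sequentially"
    by (rule filterlim_tendsto_pos_mult_at_top[OF speed \<mu> filterlim_real_sequentially])
  \<comment> \<open>The cancellation may fail at \<open>n = 0\<close>, where the quotient is 0 by
    convention.\<close>
  moreover have "\<forall>\<^sub>F n in sequentially. (\<bar>w n\<bar> / n) * real n = \<bar>w n\<bar>"
    using eventually_gt_at_top[of 0] by eventually_elim simp
  ultimately have infty: "filterlim (\<lambda>n. real_of_int \<bar>w n\<bar>) at_top sequentially"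
    by (simp add: filterlim_cong)
  then have away: "\<forall>\<^sub>F n in sequentially. real_of_int \<bar>y\<bar> < real_of_int \<bar>w n\<bar>" for y
    by (auto simp: filterlim_at_top_dense)
  from away[of x] obtain K where "\<And>n. n \<ge> K \<Longrightarrow> real_of_int \<bar>x\<bar> < real_of_int \<bar>w n\<bar>"
    by (auto simp: eventually_sequentially)
  then have "{n. w n = x} \<subseteq> {..<K}"
    by (metis (mono_tags, lifting) lessThan_iff less_irrefl mem_Collect_eq not_le subsetI)
  then show "finite {n. w n = x}"
    by (rule finite_subset) simp
  from away[of 0] obtain N where N: "\<And>n. n \<ge> N \<Longrightarrow> w n \<noteq> 0"
    by (force simp: eventually_sequentially)
  have sign: "sgn (w n) = sgn (w N)" if "n \<ge> N" for n
    using that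
  proof (induction n rule: dec_induct)
    case (step n)
    have "w n \<noteq> 0" "w (Suc n) \<noteq> 0" "\<bar>w n - w (Suc n)\<bar> = 1"
      using N step.hyps path[of n] by (auto simp: nearest_neighbour_def)
    then have "sgn (w (Suc n)) = sgn (w n)"
      by (auto simp: sgn_if)
    with step.IH show ?case by simp
  qed simp
  define s where "s = real_of_int (sgn (w N))"
  have s: "s = 1 \<or> s = -1"
    using N[of N] by (auto simp: s_def sgn_if)
  have sgn_of_int: "sgn (real_of_int y) = real_of_int (sgn y)" for y
    by (simp add: sgn_if)
  have ev: "\<forall>\<^sub>F n in sequentially. sgn (w n) = sgn (w N)"
    unfolding eventually_sequentially using sign by blast
  have "(\<lambda>n. s * (\<bar>w n\<bar> / n)) \<longlonglongrightarrow> s * \<mu>"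
    by (intro tendsto_intros speed)
  moreover have "\<forall>\<^sub>F n in sequentially. s * (\<bar>w n\<bar> / n) = w n / n"
    using ev
  proof eventually_elim
    case (elim n)
    have "w n = sgn (w N) * \<bar>w n\<bar>"
      using sgn_mult_abs[of "w n"] elim by simp
    then have "real_of_int (w n) = s * real_of_int \<bar>w n\<bar>"
      unfolding s_def by (metis of_int_mult)
    then show ?case by simp
  qed
  ultimately have 1: "(\<lambda>n. w n / n) \<longlonglongrightarrow> s * \<mu>"
    by (rule Lim_transform_eventually)
  have "filterlim (\<lambda>n. \<beta> * \<bar>w n\<bar>) at_top sequentially"
    by (rule filterlim_tendsto_pos_mult_at_top[OF tendsto_const \<beta> infty])
  then have "filterlim (\<lambda>n. - (\<beta> * \<bar>w n\<bar>)) at_bot sequentially"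
    by (simp add: filterlim_uminus_at_top)
  then have "(\<lambda>n. exp (- (\<beta> * \<bar>w n\<bar>))) \<longlonglongrightarrow> 0"
    by (rule filterlim_compose[OF exp_at_bot])
  then have "(\<lambda>n. s * (1 - exp (- (\<beta> * \<bar>w n\<bar>)))) \<longlonglongrightarrow> s * (1 - 0)"
    by (intro tendsto_intros)
  moreover have "\<forall>\<^sub>F n in sequentially. s * (1 - exp (- (\<beta> * \<bar>w n\<bar>)))
      = ant_harmonic \<beta> (w n)"
    using ev by eventually_elim (simp add: s_def ant_harmonic_def sgn_of_int flip: of_int_abs)
  ultimately have 2: "(\<lambda>n. ant_harmonic \<beta> (w n)) \<longlonglongrightarrow> s"
    using Lim_transform_eventually by force
  from s 1 2 show "\<exists>s::real. (s = 1 \<or> s = -1) \<and> (\<lambda>n. w n / n) \<longlonglongrightarrow> s * \<mu>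
      \<and> (\<lambda>n. ant_harmonic \<beta> (w n)) \<longlonglongrightarrow> s"
    by blast
qed

section \<open>Drift and the law of large numbers\<close>

locale ant_walk_int = ant_random_walk M nearest_neighbour \<beta> 0 X
  for M :: "'a measure" and \<beta> and X :: "nat \<Rightarrow> 'a \<Rightarrow> int"
begin

section \<open>The Markov property\<close>

lemma X_measurable' [measurable]: "X n \<in> measurable M (count_space UNIV)"
  by (rule X_measurable)

text \<open>Evaluating the weights requires a past along edges, which has to be derived from the
  step rule by induction on \<open>n\<close>; hence the hypothesis.\<close>

lemma next_step_prob_neighbour:
  assumes "AE \<omega> in M. \<forall>k<n. nearest_neighbour (X k \<omega>) (X (Suc k) \<omega>)"
  shows "AE \<omega> in M. nearest_neighbour (X n \<omega>) y \<longrightarrow>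
    next_step_prob M X n y \<omega> = ant_transition \<beta> (X n \<omega>) y"
  using assms X_start X_step[of n y]
proof eventually_elim
  case (elim \<omega>)
  show ?case
  proof
    assume adj: "nearest_neighbour (X n \<omega>) y"
    show "next_step_prob M X n y \<omega> = ant_transition \<beta> (X n \<omega>) y"
      using ant_weight_ratio[of n "\<lambda>k. X k \<omega>" y \<beta>, OF _ elim(2) adj] elim(1) mp[OF elim(3) adj]
      by simp
  qed
qed

text \<open>Given \<open>X n = x\<close>, the probabilities of the two neighbours already add up to
  1, so no mass is left for a jump elsewhere.\<close>

lemma step_nearest_neighbour:
  assumes "AE \<omega> in M. \<forall>k<n. nearest_neighbour (X k \<omega>) (X (Suc k) \<omega>)"
  shows "AE \<omega> in M. nearest_neighbour (X n \<omega>) (X (Suc n) \<omega>)"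
proof -
  have "AE \<omega> in M. X n \<omega> = x \<longrightarrow> nearest_neighbour (X n \<omega>) (X (Suc n) \<omega>)" for x
  proof -
    let ?S = "{\<omega> \<in> space M. X n \<omega> = x}"
      and ?J = "\<lambda>y. {\<omega> \<in> space M. X n \<omega> = x \<and> X (Suc n) \<omega> = y}"
    have joint: "prob (?J y) = ant_transition \<beta> x y * prob ?S"
      if "nearest_neighbour x y" for y
    proof (rule prob_next_step[OF X_measurable])
      show "AE \<omega> in M. X n \<omega> = x \<longrightarrow> next_step_prob M X n y \<omega> = ant_transition \<beta> x y"
        using next_step_prob_neighbour[OF assms, of y] by eventually_elim (use that in auto)
    qed
    have "prob (?S - (?J (x - 1) \<union> ?J (x + 1))) = prob ?S - (prob (?J (x - 1)) + prob (?J (x + 1)))"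
      by (subst finite_measure_Diff, auto)+ (subst finite_measure_Union, auto)
    also have "\<dots> = prob ?S - (ant_transition \<beta> x (x - 1) + ant_transition \<beta> x (x + 1)) * prob ?S"
      by (simp add: joint nearest_neighbour_def distrib_right)
    also have "\<dots> = 0"
      by (simp add: ant_transition_sum)
    finally have "AE \<omega> in M. \<omega> \<notin> ?S - (?J (x - 1) \<union> ?J (x + 1))"
      by (subst (asm) prob_eq_0) auto
    then show ?thesis
      using AE_space by eventually_elim (auto simp: nearest_neighbour_def)
  qed
  \<comment> \<open>The integers are countable, so the exceptional null sets for the individual
    \<open>x\<close> may be united.\<close>
  then have "AE \<omega> in M. \<forall>x. X n \<omega> = x \<longrightarrow> nearest_neighbour (X n \<omega>) (X (Suc n) \<omega>)"
    by (simp only: AE_all_countable) blast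
  then show ?thesis
    by simp
qed

lemma AE_nearest_neighbour_upto: "AE \<omega> in M. \<forall>k<n. nearest_neighbour (X k \<omega>) (X (Suc k) \<omega>)"
proof (induction n)
  case (Suc n)
  show ?case
    using Suc.IH step_nearest_neighbour[OF Suc.IH] by eventually_elim (metis less_antisym)
qed (rule AE_I2, blast)

lemma AE_nearest_neighbour: "AE \<omega> in M. \<forall>n. nearest_neighbour (X n \<omega>) (X (Suc n) \<omega>)"
  by (rule iffD2[OF AE_all_countable], rule allI, rule step_nearest_neighbour,
      rule AE_nearest_neighbour_upto)

lemma AE_next_step_prob: "AE \<omega> in M. next_step_prob M X n y \<omega> = ant_transition \<beta> (X n \<omega>) y"
proof -
  have "AE \<omega> in M. \<not> nearest_neighbour (X n \<omega>) y \<longrightarrow> next_step_prob M X n y \<omega> = 0"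
  proof (rule next_step_prob_eq_0[OF X_measurable])
    show "AE \<omega> in M. \<not> nearest_neighbour (X n \<omega>) y \<longrightarrow> X (Suc n) \<omega> \<noteq> y"
      using AE_nearest_neighbour by eventually_elim auto
  qed
  with next_step_prob_neighbour[OF AE_nearest_neighbour_upto, of n y] show ?thesis
    by eventually_elim (auto simp: ant_transition_def)
qed

lemma markov_chain_ant: "markov_chain M X (ant_transition \<beta>)"
  by (simp add: markov_chain_def ant_transition_nonneg ant_transition_has_sum X_measurable
      AE_next_step_prob)

lemma prob_joint:
  "\<P>(\<omega> in M. X n \<omega> = x \<and> X (Suc n) \<omega> = y) = ant_transition \<beta> x y * \<P>(\<omega> in M. X n \<omega> = x)"
proof (rule prob_next_step[OF X_measurable])
  show "AE \<omega> in M. X n \<omega> = x \<longrightarrow> next_step_prob M X n y \<omega> = ant_transition \<beta> x y"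
    using AE_next_step_prob[of n y] by eventually_elim auto
qed

lemma cond_prob_step:
  assumes "\<P>(\<omega> in M. X n \<omega> = x) > 0"
  shows "\<P>(\<omega> in M. X (Suc n) \<omega> = y \<bar> X n \<omega> = x) = ant_transition \<beta> x y"
  using assms prob_joint[of n x y] by (simp add: cond_prob_def conj_commute)

section \<open>Finite range and expectations along the walk\<close>

lemma AE_X_bounded: "AE \<omega> in M. \<forall>n. \<bar>X n \<omega>\<bar> \<le> int n"
  using X_start AE_nearest_neighbour
proof eventually_elim
  case (elim \<omega>)
  show ?case
  proof
    fix n
    show "\<bar>X n \<omega>\<bar> \<le> int n"
    proof (induction n)
      case (Suc n)
      moreover have "\<bar>X n \<omega> - X (Suc n) \<omega>\<bar> = 1"
        using elim(2) by (simp add: nearest_neighbour_def)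
      ultimately show ?case by linarith
    qed (simp add: elim(1))
  qed
qed

lemma measurable_comp_X [measurable]: "(\<lambda>\<omega>. f (X n \<omega>)) \<in> borel_measurable M"
  for f :: "int \<Rightarrow> real"
  by (rule measurable_compose[OF X_measurable]) simp

text \<open>Almost surely \<open>X n\<close> lies in a finite set, so even exponentially growing
  functions of it are bounded.\<close>

lemma integrable_comp_X: "integrable M (\<lambda>\<omega>. f (X n \<omega>))" for f :: "int \<Rightarrow> real"
proof (rule integrable_const_bound)
  show "AE \<omega> in M. norm (f (X n \<omega>)) \<le> (\<Sum>x\<in>{- int n..int n}. \<bar>f x\<bar>)"
    using AE_X_bounded
  proof eventually_elim
    case (elim \<omega>)
    then have "X n \<omega> \<in> {- int n..int n}"
      using abs_le_iff[of "X n \<omega>" "int n"] by auto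
    then show ?case
      using member_le_sum[of "X n \<omega>" "{- int n..int n}" "\<lambda>x. \<bar>f x\<bar>"] by simp
  qed
qed simp

lemma expectation_comp_X:
  fixes f :: "int \<Rightarrow> real"
  shows "expectation (\<lambda>\<omega>. f (X n \<omega>)) = (\<Sum>x\<in>{- int n..int n}. f x * \<P>(\<omega> in M. X n \<omega> = x))"
proof -
  let ?S = "{- int n..int n}" and ?A = "\<lambda>x. {\<omega> \<in> space M. X n \<omega> = x}"
  have "expectation (\<lambda>\<omega>. f (X n \<omega>)) = expectation (\<lambda>\<omega>. \<Sum>x\<in>?S. f x * indicator (?A x) \<omega>)"
  proof (rule integral_cong_AE)
    show "AE \<omega> in M. f (X n \<omega>) = (\<Sum>x\<in>?S. f x * indicator (?A x) \<omega>)"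
      using AE_X_bounded AE_space
    proof eventually_elim
      case (elim \<omega>)
      then have "X n \<omega> \<in> ?S"
        using abs_le_iff[of "X n \<omega>" "int n"] by auto
      moreover have "(\<Sum>x\<in>?S. f x * indicator (?A x) \<omega>) = (\<Sum>x\<in>?S. if x = X n \<omega> then f x else 0)"
        using elim(2) by (intro sum.cong) auto
      ultimately show ?case by simp
    qed
  qed measurable
  also have "\<dots> = (\<Sum>x\<in>?S. expectation (\<lambda>\<omega>. f x * indicator (?A x) \<omega>))"
    by (rule Bochner_Integration.integral_sum)
      (auto intro!: integrable_mult_right integrable_real_indicator simp: less_top[symmetric])
  also have "\<dots> = (\<Sum>x\<in>?S. f x * \<P>(\<omega> in M. X n \<omega> = x))"
    by (intro sum.cong) auto
  finally show ?thesis .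
qed

text \<open>The expectation is split over the finitely many possible pairs of consecutive positions,
  whose probabilities are given by \<open>prob_joint\<close>.\<close>

lemma expectation_step:
  fixes f :: "int \<Rightarrow> real"
  shows "expectation (\<lambda>\<omega>. f (X (Suc n) \<omega>)) = expectation (\<lambda>\<omega>. ant_operator \<beta> f (X n \<omega>))"
proof -
  let ?S = "{- int n..int n}"
    and ?J = "\<lambda>x y. {\<omega> \<in> space M. X n \<omega> = x \<and> X (Suc n) \<omega> = y}"
  have int: "integrable M (\<lambda>\<omega>. c * indicator (?J x y) \<omega>)" for c :: real and x y
    by (intro integrable_mult_right integrable_real_indicator) (auto simp: less_top[symmetric])
  have "expectation (\<lambda>\<omega>. f (X (Suc n) \<omega>)) = expectation (\<lambda>\<omega>. \<Sum>x\<in>?S.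
      f (x + 1) * indicator (?J x (x + 1)) \<omega> + f (x - 1) * indicator (?J x (x - 1)) \<omega>)"
  proof (rule integral_cong_AE)
    show "AE \<omega> in M. f (X (Suc n) \<omega>) = (\<Sum>x\<in>?S.
      f (x + 1) * indicator (?J x (x + 1)) \<omega> + f (x - 1) * indicator (?J x (x - 1)) \<omega>)"
      using AE_X_bounded AE_nearest_neighbour AE_space
    proof eventually_elim
      case (elim \<omega>)
      then have "X n \<omega> \<in> ?S"
        using abs_le_iff[of "X n \<omega>" "int n"] by auto
      moreover have "X (Suc n) \<omega> = X n \<omega> + 1 \<or> X (Suc n) \<omega> = X n \<omega> - 1"
        using elim(2)[rule_format, of n] unfolding nearest_neighbour_def by linarith
      then have "(\<Sum>x\<in>?S. f (x + 1) * indicator (?J x (x + 1)) \<omega> + f (x - 1) * indicator (?J x (x - 1)) \<omega>)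
          = (\<Sum>x\<in>?S. if x = X n \<omega> then f (X (Suc n) \<omega>) else 0)"
        using elim(3) by (intro sum.cong) (auto simp: indicator_def)
      ultimately show ?case by simp
    qed
  qed measurable
  also have "\<dots> = (\<Sum>x\<in>?S. expectation (\<lambda>\<omega>.
      f (x + 1) * indicator (?J x (x + 1)) \<omega> + f (x - 1) * indicator (?J x (x - 1)) \<omega>))"
    by (rule Bochner_Integration.integral_sum) (intro Bochner_Integration.integrable_add int)
  also have "\<dots> = (\<Sum>x\<in>?S. f (x + 1) * prob (?J x (x + 1)) + f (x - 1) * prob (?J x (x - 1)))"
    by (subst Bochner_Integration.integral_add[OF int int]) simp
  also have "\<dots> = (\<Sum>x\<in>?S. ant_operator \<beta> f x * \<P>(\<omega> in M. X n \<omega> = x))"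
    unfolding prob_joint ant_operator_def by (simp add: algebra_simps)
  also have "\<dots> = expectation (\<lambda>\<omega>. ant_operator \<beta> f (X n \<omega>))"
    by (simp add: expectation_comp_X)
  finally show ?thesis .
qed

lemma expectation_start: "expectation (\<lambda>\<omega>. f (X 0 \<omega>)) = f 0" for f :: "int \<Rightarrow> real"
proof -
  have "expectation (\<lambda>\<omega>. f (X 0 \<omega>)) = expectation (\<lambda>_. f 0)"
    by (rule integral_cong_AE) (use X_start in auto)
  then show ?thesis
    by (simp add: prob_space)
qed

section \<open>Exponential moment bounds\<close>

lemma expectation_geometric_bound:
  fixes f :: "int \<Rightarrow> real"
  assumes "0 \<le> \<rho>" and decay: "\<And>x. ant_operator \<beta> f x \<le> \<rho> * f x"
  shows "expectation (\<lambda>\<omega>. f (X n \<omega>)) \<le> \<rho> ^ n * f 0"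
proof (induction n)
  case (Suc n)
  have "expectation (\<lambda>\<omega>. f (X (Suc n) \<omega>)) \<le> expectation (\<lambda>\<omega>. \<rho> * f (X n \<omega>))"
    unfolding expectation_step
    by (intro integral_mono integrable_mult_right integrable_comp_X decay)
  also have "\<dots> \<le> \<rho> * (\<rho> ^ n * f 0)"
    using Suc \<open>0 \<le> \<rho>\<close> by (simp add: mult_left_mono)
  finally show ?case by (simp add: mult.assoc)
qed (simp add: expectation_start)

text \<open>Markov's inequality bounds the probability of the opposite event by a multiple of the
  \<open>n\<close>-th power of \<open>\<rho> / c\<close>, which is summable, and Borel-Cantelli
  applies.\<close>

lemma AE_eventually_less_power:
  fixes f :: "int \<Rightarrow> real"
  assumes "0 \<le> \<rho>" "\<rho> < c" and nonneg: "\<And>x. 0 \<le> f x"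
    and decay: "\<And>x. ant_operator \<beta> f x \<le> \<rho> * f x"
  shows "AE \<omega> in M. \<forall>\<^sub>F n in sequentially. f (X n \<omega>) < c ^ n"
proof -
  let ?A = "\<lambda>n. {\<omega> \<in> space M. c ^ n \<le> f (X n \<omega>)}"
  have "c > 0" using assms by simp
  have bound: "prob (?A n) \<le> f 0 * (\<rho> / c) ^ n" for n
  proof -
    have "prob (?A n) \<le> expectation (\<lambda>\<omega>. f (X n \<omega>)) / c ^ n"
      by (rule integral_Markov_inequality_measure[OF integrable_comp_X, of "{}"])
        (use nonneg \<open>c > 0\<close> in auto)
    also have "\<dots> \<le> \<rho> ^ n * f 0 / c ^ n"
      using expectation_geometric_bound[OF assms(1) decay] \<open>c > 0\<close> by (simp add: divide_right_mono)
    finally show ?thesis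
      by (simp add: power_divide mult.commute)
  qed
  have "summable (\<lambda>n. f 0 * (\<rho> / c) ^ n)"
    using assms \<open>c > 0\<close> by (intro summable_mult summable_geometric) simp
  then have "summable (\<lambda>n. prob (?A n))"
    by (rule summable_comparison_test') (use bound in auto)
  then have "AE \<omega> in M. \<forall>\<^sub>F n in sequentially. \<omega> \<in> space M - ?A n"
    by (intro borel_cantelli_AE1) (auto simp: less_top[symmetric])
  then show ?thesis
    by eventually_elim (auto elim!: eventually_mono)
qed

text \<open>Applied to \<open>exp (- (t * \<bar>x\<bar>))\<close> with
  \<open>c = exp (- (t * a))\<close>; the tilt \<open>t\<close> is chosen to make the decay rate
  smaller than \<open>c\<close>.\<close>

lemma AE_eventually_lower:
  assumes "a < outward \<beta> - inward \<beta>"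
  shows "AE \<omega> in M. \<forall>\<^sub>F n in sequentially. a * real n < \<bar>X n \<omega>\<bar>"
proof -
  obtain t where t: "t > 0" "exp (t * a) * (outward \<beta> * exp (- t) + inward \<beta> * exp t) < 1"
    using exists_exponential_tilt[OF outward_add_inward assms] by blast
  define \<rho> where "\<rho> = outward \<beta> * exp (- t) + inward \<beta> * exp t"
  have "\<rho> < exp (- (t * a))"
    using t(2) by (simp add: \<rho>_def exp_minus field_simps)
  moreover have "0 \<le> \<rho>"
    using outward_inward_pos[of \<beta>] by (simp add: \<rho>_def)
  moreover have "ant_operator \<beta> (\<lambda>y. exp (- (t * real_of_int \<bar>y\<bar>))) x \<le> \<rho> * exp (- (t * \<bar>x\<bar>))" for x
  proof (cases "x = 0")
    case True
    \<comment> \<open>From \<open>0\<close> the distance surely becomes 1, giving the factor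
      \<open>exp (- t)\<close>; replacing its inward share by \<open>exp t\<close> only enlarges
      it.\<close>
    have "exp (- t) = outward \<beta> * exp (- t) + inward \<beta> * exp (- t)"
      using outward_add_inward[of \<beta>] by (simp add: distrib_right[symmetric])
    also have "\<dots> \<le> \<rho>"
      using t(1) outward_inward_pos[of \<beta>] by (simp add: \<rho>_def)
    finally show ?thesis
      using True ant_operator_abs[of \<beta> "\<lambda>r. exp (- (t * r))" x] by simp
  next
    case False
    then show ?thesis
      using ant_operator_abs[of \<beta> "\<lambda>r. exp (- (t * r))" x]
      by (simp add: \<rho>_def algebra_simps exp_add exp_diff exp_minus field_simps)
  qed
  ultimately have "AE \<omega> in M. \<forall>\<^sub>F n in sequentially. exp (- (t * \<bar>X n \<omega>\<bar>)) < exp (- (t * a)) ^ n"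
    by (intro AE_eventually_less_power) auto
  then show ?thesis
  proof eventually_elim
    case (elim \<omega>)
    then show ?case
    proof eventually_elim
      case (elim n)
      then have "t * (a * real n) < t * \<bar>X n \<omega>\<bar>"
        by (simp add: exp_of_nat_mult[symmetric] mult_ac)
      with t(1) show ?case by simp
    qed
  qed
qed

lemma AE_eventually_upper:
  assumes "outward \<beta> - inward \<beta> < a"
  shows "AE \<omega> in M. \<forall>\<^sub>F n in sequentially. \<bar>X n \<omega>\<bar> < a * real n"
proof -
  \<comment> \<open>The tilt is taken with the two probabilities exchanged and \<open>a\<close>
    negated, since now large distances are penalised.\<close>
  have "\<exists>t>0. exp (t * (- a)) * (inward \<beta> * exp (- t) + outward \<beta> * exp t) < 1"
    by (rule exists_exponential_tilt) (use outward_add_inward[of \<beta>] assms in auto)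
  then obtain t where t: "t > 0" "exp (- (t * a)) * (inward \<beta> * exp (- t) + outward \<beta> * exp t) < 1"
    by auto
  define \<rho> where "\<rho> = outward \<beta> * exp t + inward \<beta> * exp (- t)"
  \<comment> \<open>At \<open>0\<close> the function \<open>exp (t \<bar>x\<bar>)\<close> may grow by more than \<open>\<rho>\<close>; the strict decrease of
    \<open>exp (- \<beta> \<bar>x\<bar>)\<close> at \<open>0\<close> compensates for this, and elsewhere that function is harmonic.\<close>
  define C where "C = exp t / (1 - exp (- \<beta>))"
  have C: "C > 0" "exp t + C * exp (- \<beta>) = C"
    using \<beta>_pos by (simp_all add: C_def field_simps)
  have "\<rho> < exp (t * a)"
    using t(2) by (simp add: \<rho>_def exp_minus field_simps)
  \<comment> \<open>By the outward drift and \<open>1 + u \<le> exp u\<close>. Hence harmonic terms,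
    which have factor 1, also stay below the factor \<open>\<rho>\<close>.\<close>
  moreover have "1 \<le> \<rho>"
  proof -
    have "1 \<le> 1 + (outward \<beta> - inward \<beta>) * t"
      using inward_less_outward[OF \<beta>_pos] t(1) by simp
    also have "\<dots> = outward \<beta> * (1 + t) + inward \<beta> * (1 + - t)"
      using outward_add_inward[of \<beta>] by (simp add: algebra_simps)
    also have "\<dots> \<le> \<rho>"
      unfolding \<rho>_def using outward_inward_pos[of \<beta>]
      by (intro add_mono mult_left_mono exp_ge_add_one_self) auto
    finally show ?thesis .
  qed
  moreover have "ant_operator \<beta> (\<lambda>y. exp (t * real_of_int \<bar>y\<bar>) + C * exp (- (\<beta> * real_of_int \<bar>y\<bar>))) x
      \<le> \<rho> * (exp (t * \<bar>x\<bar>) + C * exp (- (\<beta> * \<bar>x\<bar>)))" for x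
  proof (cases "x = 0")
    case True
    \<comment> \<open>At \<open>0\<close> the function has value \<open>1 + C\<close>, while the
      operator gives \<open>exp t + C * exp (- \<beta>)\<close>, which equals \<open>C\<close> by
      the choice of \<open>C\<close>.\<close>
    have "C \<le> \<rho> * (1 + C)"
      using mult_mono[OF \<open>1 \<le> \<rho>\<close>, of C "1 + C"] C(1) \<open>1 \<le> \<rho>\<close> by simp
    then show ?thesis
      using True C(2) ant_operator_abs[of \<beta> "\<lambda>r. exp (t * r) + C * exp (- (\<beta> * r))" x] by simp
  next
    case False
    define r where "r = real_of_int \<bar>x\<bar>"
    have "ant_operator \<beta> (\<lambda>y. exp (t * real_of_int \<bar>y\<bar>) + C * exp (- (\<beta> * real_of_int \<bar>y\<bar>))) x
        = outward \<beta> * exp (t * (r + 1)) + inward \<beta> * exp (t * (r - 1))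
          + C * (outward \<beta> * exp (- (\<beta> * (r + 1))) + inward \<beta> * exp (- (\<beta> * (r - 1))))"
      using False ant_operator_abs[of \<beta> "\<lambda>r. exp (t * r) + C * exp (- (\<beta> * r))" x]
      by (simp add: r_def distrib_left mult_ac)
    also have "\<dots> = \<rho> * exp (t * r) + C * exp (- (\<beta> * r))"
      unfolding outward_inward_exp_balance
      by (simp add: \<rho>_def exp_add exp_diff exp_minus field_simps)
    also have "\<dots> \<le> \<rho> * (exp (t * r) + C * exp (- (\<beta> * r)))"
      using mult_right_mono[OF \<open>1 \<le> \<rho>\<close>, of "C * exp (- (\<beta> * r))"] C(1) by (simp add: distrib_left)
    finally show ?thesis
      by (simp add: r_def)
  qed
  ultimately have "AE \<omega> in M. \<forall>\<^sub>F n in sequentially.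
      exp (t * \<bar>X n \<omega>\<bar>) + C * exp (- (\<beta> * \<bar>X n \<omega>\<bar>)) < exp (t * a) ^ n"
    using C(1) by (intro AE_eventually_less_power) auto
  then show ?thesis
  proof eventually_elim
    case (elim \<omega>)
    then show ?case
    proof eventually_elim
      case (elim n)
      moreover have "0 \<le> C * exp (- (\<beta> * \<bar>X n \<omega>\<bar>))"
        using C(1) by simp
      ultimately have "exp (t * \<bar>X n \<omega>\<bar>) < exp (t * a) ^ n"
        by linarith
      then have "t * \<bar>X n \<omega>\<bar> < t * (a * real n)"
        by (simp add: exp_of_nat_mult[symmetric] mult_ac)
      with t(1) show ?case by simp
    qed
  qed
qed

lemma AE_abs_speed: "AE \<omega> in M. (\<lambda>n. \<bar>X n \<omega>\<bar> / n) \<longlonglongrightarrow> outward \<beta> - inward \<beta>"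
proof -
  define \<mu> where "\<mu> = outward \<beta> - inward \<beta>"
  \<comment> \<open>The margins \<open>1 / Suc k\<close> form a countable family tending to 0, so
    one null set serves all of them.\<close>
  have "AE \<omega> in M. \<forall>k. \<forall>\<^sub>F n in sequentially.
      (\<mu> - 1 / Suc k) * n < \<bar>X n \<omega>\<bar> \<and> \<bar>X n \<omega>\<bar> < (\<mu> + 1 / Suc k) * n"
    unfolding AE_all_countable
  proof
    fix k
    have "AE \<omega> in M. \<forall>\<^sub>F n in sequentially. (\<mu> - 1 / Suc k) * n < \<bar>X n \<omega>\<bar>"
      by (rule AE_eventually_lower) (simp add: \<mu>_def)
    moreover have "AE \<omega> in M. \<forall>\<^sub>F n in sequentially. \<bar>X n \<omega>\<bar> < (\<mu> + 1 / Suc k) * n"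
      by (rule AE_eventually_upper) (simp add: \<mu>_def)
    ultimately show "AE \<omega> in M. \<forall>\<^sub>F n in sequentially.
        (\<mu> - 1 / Suc k) * n < \<bar>X n \<omega>\<bar> \<and> \<bar>X n \<omega>\<bar> < (\<mu> + 1 / Suc k) * n"
      by eventually_elim (rule eventually_conj)
  qed
  then have "AE \<omega> in M. (\<lambda>n. \<bar>X n \<omega>\<bar> / n) \<longlonglongrightarrow> \<mu>"
  proof eventually_elim
    case (elim \<omega>)
    show ?case
    proof (rule tendstoI)
      fix e :: real
      assume "e > 0"
      then obtain k where k: "1 / real (Suc k) < e"
        using reals_Archimedean[of e] by (auto simp: inverse_eq_divide)
      show "\<forall>\<^sub>F n in sequentially. dist (\<bar>X n \<omega>\<bar> / n) \<mu> < e"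
        using elim[rule_format, of k] eventually_gt_at_top[of 0]
      proof eventually_elim
        case (elim n)
        then have "\<mu> - 1 / Suc k < \<bar>X n \<omega>\<bar> / n" "\<bar>X n \<omega>\<bar> / n < \<mu> + 1 / Suc k"
          by (simp_all only: pos_less_divide_eq pos_divide_less_eq of_nat_0_less_iff)
        with k show ?case
          unfolding dist_real_def by linarith
      qed
    qed
  qed
  then show ?thesis
    by (simp add: \<mu>_def)
qed

section \<open>Transience and the law of the limiting sign\<close>

lemma transient_ant: "transient M X"
  unfolding transient_def
proof
  fix x
  show "AE \<omega> in M. finite {n. X n \<omega> = x}"
    using AE_nearest_neighbour AE_abs_speed
  proof eventually_elim
    case (elim \<omega>)
    show ?case
      by (rule nearest_neighbour_path_speed(1)[OF _ elim(2) _ \<beta>_pos])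
        (use elim(1) inward_less_outward[OF \<beta>_pos] in auto)
  qed
qed

text \<open>Harmonicity keeps the expectation of \<open>ant_harmonic \<beta> (X n)\<close> at its
  initial value 0. By dominated convergence \<open>Y / \<mu>\<close>, which is almost surely 1 or
  -1, has mean 0, so both values are equally likely.\<close>

lemma law_of_large_numbers:
  defines "\<mu> \<equiv> outward \<beta> - inward \<beta>"
  shows "\<exists>Y \<in> borel_measurable M. (AE \<omega> in M. (\<lambda>n. X n \<omega> / n) \<longlonglongrightarrow> Y \<omega>)
    \<and> \<P>(\<omega> in M. Y \<omega> = \<mu>) = 1 / 2 \<and> \<P>(\<omega> in M. Y \<omega> = - \<mu>) = 1 / 2"
proof (intro bexI conjI)
  have \<mu>: "\<mu> > 0"
    using inward_less_outward[OF \<beta>_pos] by (simp add: \<mu>_def)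
  \<comment> \<open>Using \<open>lim\<close> gives a measurable function on the whole space; its
    value where the limit fails to exist matters only on a null set.\<close>
  define Y where "Y \<omega> = lim (\<lambda>n. X n \<omega> / n)" for \<omega>
  let ?g = "ant_harmonic \<beta>"
  show Y[measurable]: "(\<lambda>\<omega>. Y \<omega>) \<in> borel_measurable M"
    unfolding Y_def by measurable
  have lim: "AE \<omega> in M. (\<lambda>n. X n \<omega> / n) \<longlonglongrightarrow> Y \<omega> \<and> (Y \<omega> = \<mu> \<or> Y \<omega> = - \<mu>)
      \<and> (\<lambda>n. ?g (X n \<omega>)) \<longlonglongrightarrow> Y \<omega> / \<mu>"
    using AE_nearest_neighbour AE_abs_speed
  proof eventually_elim
    case (elim \<omega>)
    have "\<exists>s::real. (s = 1 \<or> s = -1) \<and> (\<lambda>n. X n \<omega> / n) \<longlonglongrightarrow> s * \<mu> \<and> (\<lambda>n. ?g (X n \<omega>)) \<longlonglongrightarrow> s"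
      by (rule nearest_neighbour_path_speed(2)[OF _ _ \<mu> \<beta>_pos]) (use elim in \<open>auto simp: \<mu>_def\<close>)
    then obtain s :: real where s: "s = 1 \<or> s = -1" "(\<lambda>n. X n \<omega> / n) \<longlonglongrightarrow> s * \<mu>"
        "(\<lambda>n. ?g (X n \<omega>)) \<longlonglongrightarrow> s"
      by blast
    have "Y \<omega> = s * \<mu>"
      unfolding Y_def by (rule limI[OF s(2)])
    with s \<mu> show ?case by auto
  qed
  then show "AE \<omega> in M. (\<lambda>n. X n \<omega> / n) \<longlonglongrightarrow> Y \<omega>"
    by eventually_elim blast
  have g0: "expectation (\<lambda>\<omega>. ?g (X n \<omega>)) = 0" for n
  proof (induction n)
    case (Suc n)
    then show ?case by (simp add: expectation_step ant_operator_harmonic)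
  qed (simp only: expectation_start, simp add: ant_harmonic_def)
  have "(\<lambda>n. expectation (\<lambda>\<omega>. ?g (X n \<omega>))) \<longlonglongrightarrow> expectation (\<lambda>\<omega>. Y \<omega> / \<mu>)"
  proof (rule integral_dominated_convergence[where w="\<lambda>_. 1"])
    show "AE \<omega> in M. (\<lambda>n. ?g (X n \<omega>)) \<longlonglongrightarrow> Y \<omega> / \<mu>"
      using lim by eventually_elim blast
    show "AE \<omega> in M. norm (?g (X n \<omega>)) \<le> 1" for n
      using \<beta>_pos by (intro AE_I2) (auto simp: ant_harmonic_def abs_mult sgn_if)
  qed auto
  then have "expectation (\<lambda>\<omega>. Y \<omega> / \<mu>) = 0"
    unfolding g0 by (rule LIMSEQ_unique[OF _ tendsto_const])
  moreover have "expectation (\<lambda>\<omega>. Y \<omega> / \<mu>) = expectation (\<lambda>\<omega>.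
      indicator {\<omega> \<in> space M. Y \<omega> = \<mu>} \<omega> - indicator {\<omega> \<in> space M. Y \<omega> = - \<mu>} \<omega>)"
  proof (rule integral_cong_AE)
    show "AE \<omega> in M. Y \<omega> / \<mu>
        = indicator {\<omega> \<in> space M. Y \<omega> = \<mu>} \<omega> - indicator {\<omega> \<in> space M. Y \<omega> = - \<mu>} \<omega>"
      using lim AE_space by eventually_elim (use \<mu> in \<open>auto simp: indicator_def\<close>)
  qed measurable
  moreover have "\<dots> = \<P>(\<omega> in M. Y \<omega> = \<mu>) - \<P>(\<omega> in M. Y \<omega> = - \<mu>)"
    by (subst Bochner_Integration.integral_diff)
      (auto intro!: integrable_real_indicator simp: less_top[symmetric])
  ultimately have eq: "\<P>(\<omega> in M. Y \<omega> = \<mu>) = \<P>(\<omega> in M. Y \<omega> = - \<mu>)"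
    by linarith
  have "AE \<omega> in M. Y \<omega> = \<mu> \<or> Y \<omega> = - \<mu>"
    using lim by eventually_elim blast
  then have "\<P>(\<omega> in M. Y \<omega> = \<mu> \<or> Y \<omega> = - \<mu>) = 1"
    by (subst prob_Collect_eq_1) auto
  \<comment> \<open>The two events are disjoint because \<open>\<mu>\<close> is positive.\<close>
  moreover have "\<P>(\<omega> in M. Y \<omega> = \<mu> \<or> Y \<omega> = - \<mu>) = \<P>(\<omega> in M. Y \<omega> = \<mu>) + \<P>(\<omega> in M. Y \<omega> = - \<mu>)"
    using \<mu> by (subst finite_measure_Union[symmetric]) (auto intro!: arg_cong[where f=prob])
  ultimately show "\<P>(\<omega> in M. Y \<omega> = \<mu>) = 1 / 2" "\<P>(\<omega> in M. Y \<omega> = - \<mu>) = 1 / 2"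
    using eq by simp_all
qed

end

theorem proposition2p1:
  fixes M :: "'a measure" and X :: "nat \<Rightarrow> 'a \<Rightarrow> int" and \<beta> :: real
  assumes "0 < \<beta>"
    and "ant_random_walk M nearest_neighbour \<beta> 0 X"
  shows "markov_chain M X (ant_transition \<beta>)
    \<and> (\<forall>n. \<P>(\<omega> in M. X n \<omega> = 0) > 0 \<longrightarrow>
          \<P>(\<omega> in M. X (Suc n) \<omega> = 1 \<bar> X n \<omega> = 0) = 1 / 2
        \<and> \<P>(\<omega> in M. X (Suc n) \<omega> = -1 \<bar> X n \<omega> = 0) = 1 / 2)
    \<and> (\<forall>n x. \<P>(\<omega> in M. X n \<omega> = x) > 0 \<longrightarrow> x \<ge> 1 \<longrightarrow>
          \<P>(\<omega> in M. X (Suc n) \<omega> = x + 1 \<bar> X n \<omega> = x) = 1 / (1 + exp (- \<beta>))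
        \<and> \<P>(\<omega> in M. X (Suc n) \<omega> = x - 1 \<bar> X n \<omega> = x) = exp (- \<beta>) / (1 + exp (- \<beta>)))
    \<and> (\<forall>n x. \<P>(\<omega> in M. X n \<omega> = x) > 0 \<longrightarrow> x \<le> -1 \<longrightarrow>
          \<P>(\<omega> in M. X (Suc n) \<omega> = x + 1 \<bar> X n \<omega> = x) = exp (- \<beta>) / (1 + exp (- \<beta>))
        \<and> \<P>(\<omega> in M. X (Suc n) \<omega> = x - 1 \<bar> X n \<omega> = x) = 1 / (1 + exp (- \<beta>)))
    \<and> transient M X
    \<and> (\<exists>Y \<in> borel_measurable M.
          (AE \<omega> in M. (\<lambda>n. real_of_int (X n \<omega>) / real n) \<longlonglongrightarrow> Y \<omega>)
        \<and> \<P>(\<omega> in M. Y \<omega> = (1 - exp (- \<beta>)) / (1 + exp (- \<beta>))) = 1 / 2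
        \<and> \<P>(\<omega> in M. Y \<omega> = - ((1 - exp (- \<beta>)) / (1 + exp (- \<beta>)))) = 1 / 2)"
proof -
  interpret ant_walk_int M \<beta> X
    using assms(2) by (rule ant_walk_int.intro)
  have speed: "(1 - exp (- \<beta>)) / (1 + exp (- \<beta>)) = outward \<beta> - inward \<beta>"
    by (simp add: outward_def inward_def diff_divide_distrib)
  show ?thesis
    unfolding speed
    by (intro conjI allI impI markov_chain_ant transient_ant law_of_large_numbers; subst cond_prob_step)
      (auto simp: ant_transition_def nearest_neighbour_def)
qed

end
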